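(* If $G$ is a finitely generated subgroup of $PL_+(I)$ with a finite generating set $X$, then the set of all breakpoints of $G$ (that is, of all elements of $G$) has finitely many orbits under the action of $G$. Moreover, this number of orbits is bounded above by the cardinality of the set of breakpoints of the generating set $X$.
   Context: $PL_+(I)$ is the group of orientation-preserving piecewise-linear homeomorphisms of $I=[0,1]$ with finitely many breaks in slope, acting on $[0,1]$ on the right. A point $x\in(0,1)$ is a breakpoint of $g\in PL_+(I)$ if the derivative of $g$ does not exist at $x$. For a set $Y\subset PL_+(I)$, the set of breakpoints of $Y$ is $\mathscr{B}_Y=\{x\in(0,1) : x\text{ is a breakpoint of some } g\in Y\}$. *)

theory Defs
  imports "HOL-Analysis.Analysis" "HOL-Algebra.Group_Action" "HOL-Algebra.Generated_Groups"
begin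

text \<open>The finite exceptional set \<open>P\<close> makes this piecewise linearity with finitely many breaks.\<close>

definition piecewise_linear_I :: "(real \<Rightarrow> real) \<Rightarrow> bool" where
  "piecewise_linear_I f \<longleftrightarrow>
     (\<exists>P. finite P \<and>
        (\<forall>a b. {a<..<b} \<subseteq> {0..1} - P \<longrightarrow> (\<exists>m c. \<forall>x\<in>{a<..<b}. f x = m * x + c)))"

text \<open>
  Homeomorphisms of the unit interval are represented by functions that are \<open>undefined\<close>
  outside it (as in \<open>BijGroup\<close>), so that equality in the group is equality on the interval.
  A homeomorphism of an interval preserves orientation iff it is increasing.
  The group acts on the right: \<open>f \<otimes> g\<close> is ``first \<open>f\<close>, then \<open>g\<close>''.
\<close>

definition PL_plus :: "(real \<Rightarrow> real) monoid" where
  "PL_plus =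
     \<lparr>carrier = {f \<in> extensional {0..1}.
                   (\<exists>f'. homeomorphism {0..1} {0..1} f f') \<and>
                   strict_mono_on {0..1} f \<and>
                   piecewise_linear_I f},
      mult = (\<lambda>f g. compose {0..1} g f),
      one = (\<lambda>x\<in>{0..1}. x)\<rparr>"

lemma group_PL_plus: "group PL_plus"
proof (rule groupI)
  fix f g assume "f \<in> carrier PL_plus" "g \<in> carrier PL_plus"
  then obtain f' g' P Q where f: "f \<in> extensional {0..1}" "homeomorphism {0..1} {0..1} f f'"
      "strict_mono_on {0..1} f" and P: "finite P"
      "\<And>a b. {a<..<b} \<subseteq> {0..1} - P \<Longrightarrow> \<exists>m c. \<forall>x\<in>{a<..<b}. f x = m * x + c"
    and g: "g \<in> extensional {0..1}" "homeomorphism {0..1} {0..1} g g'"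
      "strict_mono_on {0..1} g" and Q: "finite Q"
      "\<And>a b. {a<..<b} \<subseteq> {0..1} - Q \<Longrightarrow> \<exists>m c. \<forall>x\<in>{a<..<b}. g x = m * x + c"
    unfolding PL_plus_def piecewise_linear_I_def by auto
  have fI: "f x \<in> {0..1}" if "x \<in> {0..1}" for x
    using f(2) that by (auto simp: homeomorphism_def)
  have "homeomorphism {0..1} {0..1} (g \<circ> f) (f' \<circ> g')"
    using homeomorphism_compose[OF f(2) g(2)] .
  then have 1: "homeomorphism {0..1} {0..1} (compose {0..1} g f) (f' \<circ> g')"
    by (rule homeomorphism_cong) (auto simp: compose_def)
  have 2: "strict_mono_on {0..1} (compose {0..1} g f)"
  proof (rule strict_mono_onI)
    fix r s :: real assume "r \<in> {0..1}" "s \<in> {0..1}" "r < s"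
    then show "compose {0..1} g f r < compose {0..1} g f s"
      using strict_mono_onD[OF f(3)] strict_mono_onD[OF g(3)] fI by (simp add: compose_def)
  qed
  have "\<exists>m c. \<forall>x\<in>{a<..<b}. compose {0..1} g f x = m * x + c"
    if ab: "{a<..<b} \<subseteq> {0..1} - (P \<union> f' ` Q)" for a b
  proof (cases "a < b")
    case True
    have abI: "{a..b} \<subseteq> {0..1}"
    proof -
      have "closure {a<..<b} \<subseteq> closure {0..1}" using ab by (intro closure_mono) auto
      then show ?thesis using True by simp
    qed
    obtain m c where mc: "\<forall>x\<in>{a<..<b}. f x = m * x + c" using P(2)[of a b] ab by auto
    have "{f a<..<f b} \<subseteq> {0..1} - Q"
    proof
      fix y assume y: "y \<in> {f a<..<f b}"
      have y01: "y \<in> {0..1}" using y fI[of a] fI[of b] abI True by auto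
      define x where "x = f' y"
      have x: "x \<in> {0..1}" "f x = y" using f(2) y01 unfolding x_def homeomorphism_def by auto
      have "a < x" "x < b"
        using y x abI True strict_mono_onD[OF f(3), of x a] strict_mono_onD[OF f(3), of b x]
        by (auto simp: not_less dest!: leI) 
           (smt (verit, best) atLeastAtMost_iff subset_iff)+
      then show "y \<in> {0..1} - Q" using ab y01 unfolding x_def by auto
    qed
    then obtain n d where nd: "\<forall>x\<in>{f a<..<f b}. g x = n * x + d" using Q(2) by meson
    have "compose {0..1} g f x = (n * m) * x + (n * c + d)" if x: "x \<in> {a<..<b}" for x
    proof -
      have "x \<in> {0..1}" "a \<in> {0..1}" "b \<in> {0..1}" using x abI True by auto
      then have "f x \<in> {f a<..<f b}" using x strict_mono_onD[OF f(3)] by auto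
      with nd mc x \<open>x \<in> {0..1}\<close> show ?thesis by (simp add: compose_def algebra_simps)
    qed
    then show ?thesis by blast
  qed auto
  then have "piecewise_linear_I (compose {0..1} g f)"
    unfolding piecewise_linear_I_def using P(1) Q(1) by (intro exI[of _ "P \<union> f' ` Q"]) auto
  then show "f \<otimes>\<^bsub>PL_plus\<^esub> g \<in> carrier PL_plus"
    using 1 2 by (auto simp: PL_plus_def)
next
  have "homeomorphism {0..1} {0..1} (\<lambda>x\<in>{0..1}. x) (\<lambda>x. x :: real)"
    by (rule homeomorphism_cong[OF homeomorphism_ident]) auto
  moreover have "piecewise_linear_I (\<lambda>x\<in>{0..1}. x)"
    unfolding piecewise_linear_I_def
    by (intro exI[of _ "{}"] conjI allI impI exI[of _ 1] exI[of _ 0]) auto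
  ultimately show "\<one>\<^bsub>PL_plus\<^esub> \<in> carrier PL_plus"
    by (auto simp: PL_plus_def strict_mono_on_def)
next
  fix f g h assume "f \<in> carrier PL_plus" "g \<in> carrier PL_plus" "h \<in> carrier PL_plus"
  then show "f \<otimes>\<^bsub>PL_plus\<^esub> g \<otimes>\<^bsub>PL_plus\<^esub> h = f \<otimes>\<^bsub>PL_plus\<^esub> (g \<otimes>\<^bsub>PL_plus\<^esub> h)"
    by (auto simp: PL_plus_def compose_def homeomorphism_def fun_eq_iff)
next
  fix f assume "f \<in> carrier PL_plus"
  then show "\<one>\<^bsub>PL_plus\<^esub> \<otimes>\<^bsub>PL_plus\<^esub> f = f"
    by (auto simp: PL_plus_def compose_def extensional_def fun_eq_iff)
next
  fix f assume "f \<in> carrier PL_plus"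
  then obtain f' P where f: "f \<in> extensional {0..1}" "homeomorphism {0..1} {0..1} f f'"
      "strict_mono_on {0..1} f" and P: "finite P"
      "\<And>a b. {a<..<b} \<subseteq> {0..1} - P \<Longrightarrow> \<exists>m c. \<forall>x\<in>{a<..<b}. f x = m * x + c"
    unfolding PL_plus_def piecewise_linear_I_def by auto
  have f': "f' y \<in> {0..1}" "f (f' y) = y" if "y \<in> {0..1}" for y
    using f(2) that by (auto simp: homeomorphism_def)
  have mono': "f' r < f' s" if "r \<in> {0..1}" "s \<in> {0..1}" "r < s" for r s
    using that f' strict_mono_onD[OF f(3), of "f' s" "f' r"] by (metis less_asym linorder_neqE)
  define h where "h = restrict f' {0..1}"
  have 1: "homeomorphism {0..1} {0..1} h f"
    by (rule homeomorphism_cong[OF homeomorphism_symD[OF f(2)]]) (auto simp: h_def)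
  have 2: "strict_mono_on {0..1} h"
    using mono' by (auto intro!: strict_mono_onI simp: h_def)
  have "\<exists>m c. \<forall>y\<in>{a<..<b}. h y = m * y + c"
    if ab: "{a<..<b} \<subseteq> {0..1} - f ` P" for a b
  proof (cases "a < b")
    case True
    have abI: "{a..b} \<subseteq> {0..1}"
    proof -
      have "closure {a<..<b} \<subseteq> closure {0..1}" using ab by (intro closure_mono) auto
      then show ?thesis using True by simp
    qed
    then have ab01: "a \<in> {0..1}" "b \<in> {0..1}" using True by auto
    have img: "f x \<in> {a<..<b}" if "x \<in> {f' a<..<f' b}" for x
    proof -
      have "x \<in> {0..1}" using that f'(1)[OF ab01(1)] f'(1)[OF ab01(2)] by auto
      then show ?thesis
        using that strict_mono_onD[OF f(3), of "f' a" x] strict_mono_onD[OF f(3), of x "f' b"]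
          f'[OF ab01(1)] f'[OF ab01(2)] by auto
    qed
    have "{f' a<..<f' b} \<subseteq> {0..1} - P"
    proof
      fix x assume x: "x \<in> {f' a<..<f' b}"
      have "x \<in> {0..1}" using x f'(1)[OF ab01(1)] f'(1)[OF ab01(2)] by auto
      moreover have "x \<notin> P" using img[OF x] ab by auto
      ultimately show "x \<in> {0..1} - P" by simp
    qed
    then obtain m c where mc: "\<forall>x\<in>{f' a<..<f' b}. f x = m * x + c" using P(2) by meson
    have eq: "y = m * f' y + c" if "y \<in> {a<..<b}" for y
    proof -
      have y: "y \<in> {0..1}" using that abI by auto
      then have "f' y \<in> {f' a<..<f' b}" using that mono' ab01 by auto
      then show ?thesis using mc f'(2)[OF y] by auto
    qed
    have "m \<noteq> 0"
      using eq[of "(2*a+b)/3"] eq[of "(a+2*b)/3"] True by auto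
    then have "h y = (1/m) * y + (- c/m)" if "y \<in> {a<..<b}" for y
      using eq[OF that] that abI by (auto simp: h_def field_simps)
    then show ?thesis by blast
  qed auto
  then have 3: "piecewise_linear_I h"
    unfolding piecewise_linear_I_def using P(1) by (intro exI[of _ "f ` P"]) auto
  show "\<exists>h\<in>carrier PL_plus. h \<otimes>\<^bsub>PL_plus\<^esub> f = \<one>\<^bsub>PL_plus\<^esub>"
    using 1 2 3 f' by (intro bexI[of _ h]) (auto simp: PL_plus_def h_def compose_def fun_eq_iff)
qed

definition breakpoints :: "(real \<Rightarrow> real) set \<Rightarrow> real set" where
  "breakpoints Y = {x \<in> {0<..<1}. \<exists>g\<in>Y. \<not> g differentiable (at x)}"

text \<open>
  The orbit of \<open>x\<close> is \<open>{g x |g. g \<in> G}\<close>; the library's \<open>orbits\<close> only uses the carrier of its group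
  argument, so it applies verbatim to this right action, where \<open>x \<cdot> g\<close> is \<open>g x\<close>.
\<close>

definition breakpoint_orbits :: "(real \<Rightarrow> real) set \<Rightarrow> real set set" where
  "breakpoint_orbits G = orbits (PL_plus\<lparr>carrier := G\<rparr>) (breakpoints G) (\<lambda>g x. g x)"

end

theory Submission
  imports Defs
begin

text \<open>
  By the chain rule a breakpoint of a product \<open>f \<otimes> g\<close> is a breakpoint of \<open>f\<close> or is moved by \<open>f\<close> to
  a breakpoint of \<open>g\<close>, and a breakpoint of \<open>f\<inverse>\<close> is moved by \<open>f\<inverse>\<close> to a breakpoint of \<open>f\<close>, because
  one-sided slopes of elements of \<open>PL\<^sub>+(I)\<close> are positive. Hence every breakpoint of \<open>G\<close> lies in the
  orbit of a breakpoint of \<open>X\<close>.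
\<close>

lemma PL_plus_mem:
  assumes "f \<in> carrier PL_plus"
  shows "continuous_on {0..1} f" "strict_mono_on {0..1} f" "piecewise_linear_I f"
    and "x \<in> {0..1} \<Longrightarrow> f x \<in> {0..1}"
  using assms by (auto simp: PL_plus_def homeomorphism_def)

lemma PL_plus_mult_apply:
  "x \<in> {0..1} \<Longrightarrow> (f \<otimes>\<^bsub>PL_plus\<^esub> g) x = g (f x)"
  by (simp add: PL_plus_def compose_def)

lemma PL_plus_one_apply: "x \<in> {0..1} \<Longrightarrow> \<one>\<^bsub>PL_plus\<^esub> x = x"
  by (simp add: PL_plus_def)

lemma PL_plus_inv_apply:
  assumes "f \<in> carrier PL_plus" "x \<in> {0..1}"
  shows "(inv\<^bsub>PL_plus\<^esub> f) (f x) = x" "f ((inv\<^bsub>PL_plus\<^esub> f) x) = x"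
  using PL_plus_mult_apply[OF assms(2), of f "inv\<^bsub>PL_plus\<^esub> f"]
    PL_plus_mult_apply[OF assms(2), of "inv\<^bsub>PL_plus\<^esub> f" f] assms
  by (simp_all add: group.r_inv group.l_inv group_PL_plus PL_plus_one_apply)

lemma PL_plus_interior:
  assumes f: "f \<in> carrier PL_plus" and x: "x \<in> {0<..<1}"
  shows "f x \<in> {0<..<1}"
proof -
  have "f 0 < f x" "f x < f 1"
    using strict_mono_onD[OF PL_plus_mem(2)[OF f]] x by auto
  then show ?thesis
    using PL_plus_mem(4)[OF f, of 0] PL_plus_mem(4)[OF f, of 1] by auto
qed

lemma PL_plus_isCont:
  assumes "f \<in> carrier PL_plus" "x \<in> {0<..<1}"
  shows "isCont f x"
  using continuous_on_interior[OF PL_plus_mem(1)[OF assms(1)]] assms(2) by simp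

text \<open>Off its finite exceptional set \<open>P\<close> an element is affine near each interior
  point, hence differentiable there. Finiteness makes the final bound meaningful, since
  \<open>card\<close> of an infinite set is 0.\<close>

lemma finite_breakpoints:
  assumes "finite X" "X \<subseteq> carrier PL_plus"
  shows "finite (breakpoints X)"
proof -
  have "finite {x \<in> {0<..<1}. \<not> f differentiable (at x)}" if "f \<in> X" for f
  proof -
    obtain P where P: "finite P"
        "\<And>a b. {a<..<b} \<subseteq> {0..1} - P \<Longrightarrow> \<exists>m c. \<forall>x\<in>{a<..<b}. f x = m * x + c"
      using PL_plus_mem(3)[of f] \<open>f \<in> X\<close> assms(2) unfolding piecewise_linear_I_def by blast
    have "f differentiable (at x)" if x: "x \<in> {0<..<1}" "x \<notin> P" for x
    proof -
      have "open ({0<..<1} - P)"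
        using P(1) by (intro open_Diff finite_imp_closed) auto
      then obtain e where e: "e > 0" "ball x e \<subseteq> {0<..<1} - P"
        using x by (meson DiffI open_contains_ball)
      have "{x - e<..<x + e} \<subseteq> {0..1} - P"
        using e(2) by (force simp: ball_eq_greaterThanLessThan)
      then obtain m c where mc: "\<forall>y\<in>{x - e<..<x + e}. f y = m * y + c"
        using P(2) by meson
      have "((\<lambda>y. m * y + c) has_real_derivative m) (at x)"
        by (auto intro!: derivative_eq_intros)
      then have "(f has_real_derivative m) (at x)"
        by (rule has_field_derivative_transform_within_open[where S = "{x - e<..<x + e}"])
           (use mc e(1) in auto)
      then show ?thesis by (auto simp: real_differentiable_def)
    qed
    then have "{x \<in> {0<..<1}. \<not> f differentiable (at x)} \<subseteq> P" by blast
    then show ?thesis using P(1) finite_subset by blast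
  qed
  moreover have "breakpoints X = (\<Union>f\<in>X. {x \<in> {0<..<1}. \<not> f differentiable (at x)})"
    by (auto simp: breakpoints_def)
  ultimately show ?thesis using assms(1) by auto
qed

text \<open>Strict monotonicity alone would permit a zero derivative. Piecewise linearity excludes
  it: just left of \<open>x\<close> the map is affine, with a positive slope \<open>m\<close> that
  must equal \<open>D\<close>.\<close>

lemma PL_plus_derivative_pos:
  assumes f: "f \<in> carrier PL_plus" and x: "x \<in> {0<..<1}"
    and D: "(f has_real_derivative D) (at x)"
  shows "D > 0"
proof -
  obtain P where P: "finite P"
      "\<And>a b. {a<..<b} \<subseteq> {0..1} - P \<Longrightarrow> \<exists>m c. \<forall>x\<in>{a<..<b}. f x = m * x + c"
    using PL_plus_mem(3)[OF f] unfolding piecewise_linear_I_def by blast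
  \<comment> \<open>The point \<open>x\<close> may itself lie in \<open>P\<close>, so only the other
    exceptional points are avoided. The open left half of the ball then misses all of
    \<open>P\<close>.\<close>
  have "open ({0<..<1} - (P - {x}))"
    using P(1) by (intro open_Diff finite_imp_closed) auto
  then obtain e where e: "e > 0" "ball x e \<subseteq> {0<..<1} - (P - {x})"
    using x by (meson DiffD2 DiffI open_contains_ball singletonI)
  have sub: "{x - e<..<x} \<subseteq> {0..1} - P"
    using e by (force simp: ball_eq_greaterThanLessThan)
  then obtain m c where mc: "\<forall>y\<in>{x - e<..<x}. f y = m * y + c"
    using P(2) by meson
  \<comment> \<open>Comparing \<open>f\<close> at two sample points of the affine piece, at distance
    \<open>e / 3\<close>, gives the sign of \<open>m\<close>.\<close>
  have "x - e * 2 / 3 \<in> {0..1}" "x - e / 3 \<in> {0..1}"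
    using e(1) by (auto simp del: atLeastAtMost_iff intro!: subsetD[OF sub, THEN DiffD1])
  then have "f (x - e * 2 / 3) < f (x - e / 3)"
    by (rule strict_mono_onD[OF PL_plus_mem(2)[OF f]]) (use e(1) in simp)
  then have "0 < m * (e / 3)"
    using mc e(1) by (auto simp: algebra_simps)
  then have m: "m > 0"
    using e(1) by (simp add: zero_less_mult_iff)
  have ev: "\<forall>\<^sub>F y in at_left x. f y = m * y + c"
    by (rule eventually_mono[OF eventually_at_left_real[of "x - e" x]]) (use e(1) mc in auto)
  \<comment> \<open>Continuity extends the affine formula to \<open>x\<close>, so the difference
    quotients from the left are exactly \<open>m\<close>.\<close>
  have "(f \<longlongrightarrow> f x) (at_left x)"
    using PL_plus_isCont[OF f x] by (auto simp: isCont_def intro: tendsto_within_subset)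
  then have "((\<lambda>y. m * y + c) \<longlongrightarrow> f x) (at_left x)"
    using ev by (rule Lim_transform_eventually)
  moreover have "((\<lambda>y. m * y + c) \<longlongrightarrow> m * x + c) (at_left x)"
    by (intro tendsto_intros)
  ultimately have fx: "f x = m * x + c"
    using tendsto_unique trivial_limit_at_left_real by blast
  have "((\<lambda>y. (f y - f x) / (y - x)) \<longlongrightarrow> D) (at_left x)"
    using has_field_derivative_at_within[OF D] by (simp add: has_field_derivative_iff)
  moreover have "\<forall>\<^sub>F y in at_left x. (f y - f x) / (y - x) = m"
    \<comment> \<open>The interval from \<open>x - 1\<close> to \<open>x\<close> only serves to
      supply \<open>y < x\<close>, so that \<open>y - x\<close> can be cancelled.\<close>
    using ev eventually_at_left_real[of "x - 1" x, simplified]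
  proof eventually_elim
    case (elim y)
    then have "f y - f x = m * (y - x)" by (simp add: fx algebra_simps)
    then show ?case using elim(2) by simp
  qed
  ultimately have "((\<lambda>y. m) \<longlongrightarrow> D) (at_left x)"
    by (rule Lim_transform_eventually)
  then have "D = m"
    using tendsto_unique[OF trivial_limit_at_left_real _ tendsto_const] by blast
  then show ?thesis using m by simp
qed

text \<open>This is the chain rule. The product agrees with the composition of functions only on the
  unit interval, so the derivative is transferred on its interior.\<close>

lemma PL_plus_mult_differentiable:
  assumes x: "x \<in> {0<..<1}"
    and "f differentiable (at x)" "g differentiable (at (f x))"
  shows "(f \<otimes>\<^bsub>PL_plus\<^esub> g) differentiable (at x)"
proof -
  obtain D E where "(f has_real_derivative D) (at x)" "(g has_real_derivative E) (at (f x))"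
    using assms by (auto simp: real_differentiable_def)
  then have "((\<lambda>y. g (f y)) has_real_derivative E * D) (at x)"
    by (intro DERIV_chain2)
  then have "((f \<otimes>\<^bsub>PL_plus\<^esub> g) has_real_derivative E * D) (at x)"
    by (rule has_field_derivative_transform_within_open[where S = "{0<..<1}"])
       (use x in \<open>auto simp: PL_plus_mult_apply\<close>)
  then show ?thesis by (auto simp: real_differentiable_def)
qed

text \<open>The inverse function rule needs a nonzero derivative, which
  \<open>PL_plus_derivative_pos\<close> provides.\<close>

lemma PL_plus_inv_differentiable:
  assumes f: "f \<in> carrier PL_plus" and x: "x \<in> {0<..<1}"
    and diff: "f differentiable (at ((inv\<^bsub>PL_plus\<^esub> f) x))"
  shows "(inv\<^bsub>PL_plus\<^esub> f) differentiable (at x)"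
proof -
  let ?g = "inv\<^bsub>PL_plus\<^esub> f"
  have g: "?g \<in> carrier PL_plus"
    using f group.inv_closed[OF group_PL_plus] by blast
  obtain D where D: "(f has_real_derivative D) (at (?g x))"
    using diff by (auto simp: real_differentiable_def)
  have "D > 0"
    using PL_plus_derivative_pos[OF f PL_plus_interior[OF g x] D] .
  then have "(?g has_real_derivative inverse D) (at x)"
    using D x PL_plus_isCont[OF g x] PL_plus_inv_apply(2)[OF f]
    by (intro DERIV_inverse_function[where f = f and a = 0 and b = 1]) auto
  then show ?thesis by (auto simp: real_differentiable_def)
qed

lemma generate_breakpoint_to_generator:
  assumes X: "X \<subseteq> carrier PL_plus" and h: "h \<in> generate PL_plus X"
    and x: "x \<in> {0<..<1}" "\<not> h differentiable (at x)"
  shows "\<exists>k\<in>generate PL_plus X. k x \<in> breakpoints X"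
  using h x
\<comment> \<open>The point must vary, because the hypothesis for the second factor is used at
  \<open>h1 x\<close>.\<close>
proof (induction h arbitrary: x rule: generate.induct)
  case one
  have "((\<lambda>y. y) has_real_derivative 1) (at x)" by simp
  then have "(\<one>\<^bsub>PL_plus\<^esub> has_real_derivative 1) (at x)"
    by (rule has_field_derivative_transform_within_open[where S = "{0<..<1}"])
       (use one(1) in \<open>auto simp: PL_plus_one_apply\<close>)
  then show ?case using one(2) by (auto simp: real_differentiable_def)
next
  case (incl h)
  then have "\<one>\<^bsub>PL_plus\<^esub> x \<in> breakpoints X"
    by (auto simp: breakpoints_def PL_plus_one_apply)
  then show ?case using generate.one by blast
next
  \<comment> \<open>The inverse is its own witness \<open>k\<close>: were \<open>h\<close>
    differentiable at \<open>?k x\<close>, then \<open>?k\<close> would be differentiable at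
    \<open>x\<close>.\<close>
  case (inv h)
  let ?k = "inv\<^bsub>PL_plus\<^esub> h"
  have h: "h \<in> carrier PL_plus" using inv(1) X by blast
  have "?k x \<in> {0<..<1}"
    by (rule PL_plus_interior[OF group.inv_closed[OF group_PL_plus h] inv(2)])
  moreover have "\<not> h differentiable (at (?k x))"
    using PL_plus_inv_differentiable[OF h inv(2)] inv(3) by (rule contrapos_nn[rotated])
  ultimately have "?k x \<in> breakpoints X"
    unfolding breakpoints_def using inv(1) by blast
  then show ?case using generate.inv[OF inv(1), of PL_plus] by (rule bexI)
next
  case (eng h1 h2)
  have h1: "h1 \<in> carrier PL_plus"
    using eng(1) X group.generate_in_carrier[OF group_PL_plus] by blast
  show ?case
  \<comment> \<open>If \<open>h1\<close> is smooth at \<open>x\<close>, the break comes from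
    \<open>h2\<close> at \<open>h1 x\<close>, and the witness found there is preceded by
    \<open>h1\<close>. Otherwise the witness for \<open>h1\<close> already works.\<close>
  proof (cases "h1 differentiable (at x)")
    case True
    then have "\<not> h2 differentiable (at (h1 x))"
      using PL_plus_mult_differentiable eng.prems by blast
    then obtain k where "k \<in> generate PL_plus X" "k (h1 x) \<in> breakpoints X"
      using eng.IH(2) PL_plus_interior[OF h1 eng.prems(1)] by blast
    then have "h1 \<otimes>\<^bsub>PL_plus\<^esub> k \<in> generate PL_plus X"
        "(h1 \<otimes>\<^bsub>PL_plus\<^esub> k) x \<in> breakpoints X"
      using generate.eng[OF eng(1)] eng.prems(1) by (auto simp: PL_plus_mult_apply)
    then show ?thesis by blast
  next
    case False
    then show ?thesis using eng.IH(1) eng.prems(1) by blast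
  qed
qed

text \<open>In the right action, \<open>g (k x)\<close> is the image of \<open>x\<close> under
  \<open>k \<otimes> g\<close>, and \<open>g x\<close> is the image of \<open>k x\<close> under
  \<open>inv k \<otimes> g\<close>.\<close>

lemma orbit_PL_plus_apply:
  assumes G: "subgroup G PL_plus" and k: "k \<in> G" and x: "x \<in> {0..1}"
  shows "orbit (PL_plus\<lparr>carrier := G\<rparr>) (\<lambda>g x. g x) (k x) =
         orbit (PL_plus\<lparr>carrier := G\<rparr>) (\<lambda>g x. g x) x"
proof -
  have kc: "k \<in> carrier PL_plus" using subgroup.subset[OF G] k by blast
  have "\<exists>h\<in>G. g (k x) = h x" if "g \<in> G" for g
    using subgroup.m_closed[OF G k that] PL_plus_mult_apply[OF x] by metis
  moreover have "\<exists>h\<in>G. g x = h (k x)" if "g \<in> G" for g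
    using subgroup.m_closed[OF G subgroup.m_inv_closed[OF G k] that]
      PL_plus_mult_apply[OF PL_plus_mem(4)[OF kc x]] PL_plus_inv_apply(1)[OF kc x] by metis
  ultimately show ?thesis unfolding orbit_def by fastforce
qed

theorem lemma3p1:
  fixes G X :: "(real \<Rightarrow> real) set"
  assumes "subgroup G PL_plus"
    and "finite X"
    and "X \<subseteq> carrier PL_plus"
    and "G = generate PL_plus X"
  shows "finite (breakpoint_orbits G) \<and> card (breakpoint_orbits G) \<le> card (breakpoints X)"
proof -
  let ?orb = "orbit (PL_plus\<lparr>carrier := G\<rparr>) (\<lambda>g x. g x)"
  \<comment> \<open>Every breakpoint orbit is the orbit of some breakpoint of \<open>X\<close>.
    Covering by the image of a finite set gives both finiteness and the bound.\<close>
  have "breakpoint_orbits G \<subseteq> ?orb ` breakpoints X"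
  proof
    fix O' assume "O' \<in> breakpoint_orbits G"
    then obtain x h where x: "O' = ?orb x" "x \<in> {0<..<1}" "h \<in> G" "\<not> h differentiable (at x)"
      by (auto simp: breakpoint_orbits_def orbits_def breakpoints_def)
    then obtain k where k: "k \<in> G" "k x \<in> breakpoints X"
      using generate_breakpoint_to_generator[OF assms(3), of h x] assms(4) by blast
    have "O' = ?orb (k x)"
      using orbit_PL_plus_apply[OF assms(1) k(1), of x] x by simp
    then show "O' \<in> ?orb ` breakpoints X" using k(2) by blast
  qed
  moreover have "finite (breakpoints X)"
    using finite_breakpoints assms(2,3) by blast
  ultimately show ?thesis
    by (meson card_image_le card_mono finite_imageI finite_subset le_trans)
qed

end
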